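(* The image of the $\mathcal{G}$ basis of $\mathrm{FQSym}$ in $\mathrm{NCQSym}$ consists of the quasisymmetric powersum functions in noncommuting variables indexed by singleton set compositions: for every permutation $\tau\in\mathfrak{S}_n$, $$\mathcal{G}_\tau=P_{\tau(1|2|\cdots|n)} .$$
   Context: A set composition of $[n]$ is an ordered list $\Phi=(B_1,\dots,B_k)=B_1|\cdots|B_k$ of disjoint nonempty sets with union $[n]$; $\mathrm{NCQSym}$ has monomial basis $(M_\Phi)$ indexed by set compositions. For disjoint nonempty sets of positive integers, $A>_{\widetilde D}B$ iff $|A|>|B|$, or $|A|=|B|$ and $\min(A)<\min(B)$. $P_\Phi=\sum_\Psi M_\Psi$, the sum over all set compositions $\Psi$ obtained from $\Phi$ by choosing a subset $I$ of $\{i<k:B_i>_{\widetilde D}B_{i+1}\}$ and merging (by union) $B_i$ and $B_{i+1}$ into the same block for every $i\in I$. A packed word of length $n$ is a word $w=w_1\cdots w_n$ of positive integers whose set of letters is $\{1,\dots,k\}$ for some $k$; it corresponds to the set composition $\mathsf{setcomp}(w)=B_1|\cdots|B_k$ with $i\in B_{w_i}$. The standardization $st(w)$ is the permutation obtained by labelling $1,2,\dots$ the occurrences of the letter $1$ from left to right, then continuing with the occurrences of $2$ from left to right, and so on; e.g. $st(121)=132$. $\mathrm{FQSym}$ is the Malvenuto–Reutenauer Hopf algebra of permutations with dual fundamental basis $\mathcal{G}_\tau$, regarded as a sub-Hopf algebra of $\mathrm{NCQSym}$ via $\mathcal{G}_\tau\mapsto\sum_{u\text{ packed},\ st(u)=\tau}M_{\mathsf{setcomp}(u)}$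 (with $\tau$ in one-line notation). A permutation $\tau$ acts on a set composition by place permutation, the block in place $i$ moving to place $\tau(i)$; thus $\tau(1|2|\cdots|n)=\tau^{-1}(1)|\tau^{-1}(2)|\cdots|\tau^{-1}(n)$, a set composition into singletons. *)

theory Defs
  imports Complex_Main "HOL-Library.Poly_Mapping" "HOL-Combinatorics.Permutations"
begin

definition is_set_composition :: "nat \<Rightarrow> nat set list \<Rightarrow> bool" where
  "is_set_composition n \<Phi> \<longleftrightarrow>
     (\<forall>i j. i < j \<and> j < length \<Phi> \<longrightarrow> \<Phi> ! i \<inter> \<Phi> ! j = {}) \<and>
     {} \<notin> set \<Phi> \<and> \<Union>(set \<Phi>) = {1..n}"

typedef set_composition = "{\<Phi>. \<exists>n. is_set_composition n \<Phi>}"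
  morphisms blocks Abs_set_composition
  by (rule exI[of _ "[]"]) (auto simp: is_set_composition_def)

typedef packed_word = "{w :: nat list. \<exists>k. set w = {1..k}}"
  morphisms letters Abs_packed_word
  by (rule exI[of _ "[]"]) auto

text \<open>The degree is recorded because a permutation of $[n]$, extended by the identity,
  is also a permutation of $[m]$ for every $m \ge n$.\<close>

typedef permutation = "{(n :: nat, f). f permutes {1..n}}"
  morphisms Rep_permutation Abs_permutation
  by (rule exI[of _ "(0, id)"]) auto

setup_lifting type_definition_set_composition
setup_lifting type_definition_packed_word
setup_lifting type_definition_permutation

lift_definition degree :: "permutation \<Rightarrow> nat" is fst .

lift_definition perm_fun :: "permutation \<Rightarrow> nat \<Rightarrow> nat" is snd .

definition symmetric_group :: "nat \<Rightarrow> permutation set" where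
  "symmetric_group n = {\<tau>. degree \<tau> = n}"


text \<open>Positions in words and places in set compositions are counted from 1, whereas
  \<open>!\<close> counts from 0.\<close>

lift_definition setcomp :: "packed_word \<Rightarrow> set_composition" is
  "\<lambda>w. map (\<lambda>a. {i \<in> {1..length w}. w ! (i - 1) = a}) [1..<Suc (card (set w))]"
proof -
  fix w :: "nat list"
  assume "\<exists>k. set w = {1..k}"
  then obtain k where k: "set w = {1..k}" by blast
  let ?\<Phi> = "map (\<lambda>a. {i \<in> {1..length w}. w ! (i - 1) = a}) [1..<Suc (card (set w))]"
  have nonempty: "{i. 1 \<le> i \<and> i \<le> length w \<and> w ! (i - 1) = a} \<noteq> {}"
    if "1 \<le> a" "a \<le> k" for a
  proof -
    have "a \<in> set w" using k that by auto
    then obtain j where "j < length w" "w ! j = a" by (auto simp: in_set_conv_nth)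
    then have "Suc j \<in> {i. 1 \<le> i \<and> i \<le> length w \<and> w ! (i - 1) = a}" by auto
    then show ?thesis by blast
  qed
  have letter: "1 \<le> w ! (i - 1) \<and> w ! (i - 1) \<le> k" if "1 \<le> i" "i \<le> length w" for i
    using nth_mem[of "i - 1" w] that k by auto
  have "is_set_composition (length w) ?\<Phi>"
    unfolding is_set_composition_def
  proof (intro conjI allI impI)
    fix i j assume "i < j \<and> j < length ?\<Phi>"
    then show "?\<Phi> ! i \<inter> ?\<Phi> ! j = {}" by (auto simp del: upt_Suc)
  next
    show "{} \<notin> set ?\<Phi>"
    proof
      assume "{} \<in> set ?\<Phi>"
      then obtain a where "1 \<le> a" "a \<le> k" "{i \<in> {1..length w}. w ! (i - 1) = a} = {}"
        using k by (auto simp del: upt_Suc)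
      then show False using nonempty[of a] by auto
    qed
  next
    show "\<Union>(set ?\<Phi>) = {1..length w}"
      using letter k by (auto simp del: upt_Suc simp: less_Suc_eq_le)
  qed
  then show "\<exists>n. is_set_composition n ?\<Phi>" by blast
qed

text \<open>The positions of a word in the order in which standardization labels them: those of
  the letter 1 from left to right, then those of the letter 2, and so on.\<close>

definition labelling_order :: "nat list \<Rightarrow> nat list" where
  "labelling_order w =
     concat (map (\<lambda>a. filter (\<lambda>i. w ! (i - 1) = a) [1..<Suc (length w)])
       [1..<Suc (card (set w))])"

definition standard_label :: "nat list \<Rightarrow> nat \<Rightarrow> nat" where
  "standard_label w i = Suc (length (takeWhile (\<lambda>j. j \<noteq> i) (labelling_order w)))"

lemma labelling_order_permutation:
  assumes "set w = {1..k}"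
  shows "distinct (labelling_order w)" "set (labelling_order w) = {1..length w}"
proof -
  have letter: "1 \<le> w ! (i - 1) \<and> w ! (i - 1) \<le> k" if "1 \<le> i" "i \<le> length w" for i
    using nth_mem[of "i - 1" w] that assms by auto
  show "set (labelling_order w) = {1..length w}"
    using letter assms unfolding labelling_order_def
    by (auto simp del: upt_Suc simp: less_Suc_eq_le)
  have "distinct (concat (map (\<lambda>a. filter (\<lambda>i. w ! (i - 1) = a) [1..<m]) as))"
    if "distinct as" for as m
    using that by (induction as) auto
  then show "distinct (labelling_order w)"
    unfolding labelling_order_def using distinct_upt by blast
qed

lemma standard_label_nth:
  assumes "set w = {1..k}" "r < length w"
  shows "standard_label w (labelling_order w ! r) = Suc r"
proof -
  let ?xs = "labelling_order w"
  have d: "distinct ?xs" and l: "length ?xs = length w"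
    using labelling_order_permutation[OF assms(1)] distinct_card[of ?xs] by auto
  have "takeWhile (\<lambda>j. j \<noteq> ?xs ! r) ?xs = take r ?xs"
    using d l assms(2) by (intro takeWhile_eq_take_P_nth) (auto simp: nth_eq_iff_index_eq)
  then show ?thesis using l assms(2) by (simp add: standard_label_def)
qed

lift_definition st :: "packed_word \<Rightarrow> permutation" is
  "\<lambda>w. (length w, \<lambda>i. if i \<in> {1..length w} then standard_label w i else i)"
proof -
  fix w :: "nat list"
  assume "\<exists>k. set w = {1..k}"
  then obtain k where k: "set w = {1..k}" by blast
  let ?xs = "labelling_order w"
  have d: "distinct ?xs" and s: "set ?xs = {1..length w}" and l: "length ?xs = length w"
    using labelling_order_permutation[OF k] distinct_card[of ?xs] by auto
  have surj: "{1..length w} \<subseteq> standard_label w ` {1..length w}"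
  proof
    fix x assume "x \<in> {1..length w}"
    then have r: "x - 1 < length w" "Suc (x - 1) = x" by auto
    then have "standard_label w (?xs ! (x - 1)) = x" using standard_label_nth[OF k] by metis
    moreover have "?xs ! (x - 1) \<in> {1..length w}" using r l s nth_mem by metis
    ultimately show "x \<in> standard_label w ` {1..length w}" by (metis imageI)
  qed
  have "standard_label w ` {1..length w} \<subseteq> {1..length w}"
  proof
    fix x assume "x \<in> standard_label w ` {1..length w}"
    then obtain i where "i \<in> set ?xs" "x = standard_label w i" using s by auto
    then obtain r where "r < length w" "x = standard_label w (?xs ! r)"
      using l by (metis in_set_conv_nth)
    then show "x \<in> {1..length w}" using standard_label_nth[OF k] by auto
  qed
  then have eq: "standard_label w ` {1..length w} = {1..length w}" using surj by blast
  then have "inj_on (standard_label w) {1..length w}" by (intro eq_card_imp_inj_on) auto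
  then have "bij_betw (standard_label w) {1..length w} {1..length w}"
    using eq by (simp add: bij_betw_def)
  then have "bij_betw (\<lambda>i. if i \<in> {1..length w} then standard_label w i else i)
    {1..length w} {1..length w}"
    by (rule bij_betw_cong[THEN iffD1, rotated]) auto
  then have "(\<lambda>i. if i \<in> {1..length w} then standard_label w i else i) permutes {1..length w}"
    by (rule bij_imp_permutes) auto
  then show "(length w, \<lambda>i. if i \<in> {1..length w} then standard_label w i else i)
      \<in> {(n, f). f permutes {1..n}}"
    by simp
qed


text \<open>Both algebras enter only through their underlying modules, which are free on the bases
  $(\mathcal{G}_\tau)$ and $(M_\Phi)$.\<close>

type_synonym 'a fqsym = "permutation \<Rightarrow>\<^sub>0 'a"
type_synonym 'a ncqsym = "set_composition \<Rightarrow>\<^sub>0 'a"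

definition G :: "permutation \<Rightarrow> 'a::comm_ring_1 fqsym" where
  "G \<tau> = Poly_Mapping.single \<tau> 1"

definition M :: "set_composition \<Rightarrow> 'a::comm_ring_1 ncqsym" where
  "M \<Phi> = Poly_Mapping.single \<Phi> 1"

text \<open>\<open>Poly_Mapping.map ((*) c)\<close> is multiplication by the scalar \<open>c\<close>, so this is the linear map
  with $\mathcal{G}_\tau \mapsto \sum_{st(u) = \tau} M_{setcomp(u)}$.\<close>

definition fqsym_to_ncqsym :: "'a::comm_ring_1 fqsym \<Rightarrow> 'a ncqsym" where
  "fqsym_to_ncqsym f = (\<Sum>\<tau>\<in>Poly_Mapping.keys f.
     Poly_Mapping.map ((*) (Poly_Mapping.lookup f \<tau>)) (\<Sum>u | st u = \<tau>. M (setcomp u)))"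

lemma finite_standardization_fiber: "finite {u. st u = \<tau>}"
proof (rule finite_subset)
  let ?W = "{w. set w \<subseteq> {1..degree \<tau>} \<and> length w = degree \<tau>}"
  show "finite (Abs_packed_word ` ?W)" by (intro finite_imageI finite_lists_length_eq) simp
  show "{u. st u = \<tau>} \<subseteq> Abs_packed_word ` ?W"
  proof
    fix u assume "u \<in> {u. st u = \<tau>}"
    then have l: "length (letters u) = degree \<tau>" by (auto simp: degree.rep_eq st.rep_eq)
    obtain k where k: "set (letters u) = {1..k}" using letters[of u] by auto
    then have "k \<le> length (letters u)" using card_length[of "letters u"] by simp
    then have "letters u \<in> ?W" using k l by auto
    then show "u \<in> Abs_packed_word ` ?W" by (metis imageI letters_inverse)
  qed
qed

lemma fqsym_to_ncqsym_G: "fqsym_to_ncqsym (G \<tau> :: 'a::comm_ring_1 fqsym) = (\<Sum>u | st u = \<tau>. M (setcomp u))"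
  by (simp add: fqsym_to_ncqsym_def G_def poly_mapping_eq_iff fun_eq_iff map.rep_eq when_def)


definition gt_D :: "nat set \<Rightarrow> nat set \<Rightarrow> bool" where
  "gt_D A B \<longleftrightarrow> card A > card B \<or> card A = card B \<and> Min A < Min B"

definition mergeable :: "nat set list \<Rightarrow> nat set" where
  "mergeable \<Phi> = {i. 1 \<le> i \<and> i < length \<Phi> \<and> gt_D (\<Phi> ! (i - 1)) (\<Phi> ! i)}"

text \<open>In \<open>merge_from i I \<Phi>\<close> the place of the head of \<open>\<Phi>\<close> is \<open>i\<close>; after a merge, the head
  stands for a union of original blocks the last of which is in place \<open>i\<close>.\<close>

fun merge_from :: "nat \<Rightarrow> nat set \<Rightarrow> nat set list \<Rightarrow> nat set list" where
  "merge_from i I [] = []"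
| "merge_from i I [B] = [B]"
| "merge_from i I (B # C # \<Phi>) =
     (if i \<in> I then merge_from (Suc i) I ((B \<union> C) # \<Phi>)
      else B # merge_from (Suc i) I (C # \<Phi>))"

definition merge :: "nat set \<Rightarrow> nat set list \<Rightarrow> nat set list" where
  "merge I \<Phi> = merge_from 1 I \<Phi>"

definition P :: "set_composition \<Rightarrow> 'a::comm_ring_1 ncqsym" where
  "P \<Phi> = (\<Sum>\<Psi> | \<exists>I \<subseteq> mergeable (blocks \<Phi>). blocks \<Psi> = merge I (blocks \<Phi>). M \<Psi>)"


lift_definition singletons :: "nat \<Rightarrow> set_composition" is "\<lambda>n. map (\<lambda>i. {i}) [1..<Suc n]"
proof -
  fix n :: nat
  have "is_set_composition n (map (\<lambda>i. {i}) [1..<Suc n])"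
    unfolding is_set_composition_def by (auto simp del: upt_Suc)
  then show "\<exists>m. is_set_composition m (map (\<lambda>i. {i}) [1..<Suc n])" by blast
qed

lemma is_set_composition_permuted:
  assumes f: "f permutes {1..length \<Phi>}" and c: "is_set_composition n \<Phi>"
  shows "is_set_composition n (map (\<lambda>j. \<Phi> ! (inv f j - 1)) [1..<Suc (length \<Phi>)])"
proof -
  let ?g = "\<lambda>j. inv f j - 1"
  let ?\<Psi> = "map (\<lambda>j. \<Phi> ! (inv f j - 1)) [1..<Suc (length \<Phi>)]"
  have g: "inv f permutes {1..length \<Phi>}" using f by (rule permutes_inv)
  have rng: "Suc 0 \<le> inv f j \<and> inv f j \<le> length \<Phi>" if "Suc 0 \<le> j" "j \<le> length \<Phi>" for j
    using permutes_in_image[OF g, of j] that by simp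
  have disj: "\<Phi> ! i \<inter> \<Phi> ! j = {}" if "i \<noteq> j" "i < length \<Phi>" "j < length \<Phi>" for i j
    using c that unfolding is_set_composition_def by (metis Int_commute linorder_neqE_nat)
  have img: "?g ` {1..length \<Phi>} = {..<length \<Phi>}"
  proof -
    have "?g ` {1..length \<Phi>} = (\<lambda>i. i - 1) ` (inv f ` {1..length \<Phi>})"
      by (simp add: image_image)
    also have "\<dots> = (\<lambda>i. i - 1) ` Suc ` {..<length \<Phi>}"
      using permutes_image[OF g] by (simp add: lessThan_atLeast0 image_Suc_atLeastLessThan
          atLeastLessThanSuc_atLeastAtMost)
    finally show ?thesis by (simp add: image_image)
  qed
  have "set ?\<Psi> = (!) \<Phi> ` (?g ` {1..length \<Phi>})"
    by (auto simp del: upt_Suc simp: less_Suc_eq_le)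
  also have "\<dots> = set \<Phi>" unfolding img by (auto simp: set_conv_nth)
  finally have set_eq: "set ?\<Psi> = set \<Phi>" .
  show "is_set_composition n ?\<Psi>"
    unfolding is_set_composition_def
  proof (intro conjI allI impI)
    fix i j assume ij: "i < j \<and> j < length ?\<Psi>"
    then have "inv f (Suc i) \<noteq> inv f (Suc j)"
      using permutes_inj[OF g] by (auto dest: injD)
    with ij rng[of "Suc i"] rng[of "Suc j"] have "inv f (Suc i) - 1 \<noteq> inv f (Suc j) - 1"
      by (auto simp del: upt_Suc)
    moreover have "inv f (Suc i) - 1 < length \<Phi>" "inv f (Suc j) - 1 < length \<Phi>"
      using ij rng[of "Suc i"] rng[of "Suc j"] by (auto simp del: upt_Suc)
    ultimately show "?\<Psi> ! i \<inter> ?\<Psi> ! j = {}"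
      using ij rng[of "Suc i"] rng[of "Suc j"]
        disj[of "inv f (Suc i) - 1" "inv f (Suc j) - 1"] by (simp del: upt_Suc)
  next
    show "{} \<notin> set ?\<Psi>" "\<Union>(set ?\<Psi>) = {1..n}"
      using c unfolding set_eq is_set_composition_def by auto
  qed
qed

text \<open>A permutation of $[k]$ acts on the set compositions with $k$ blocks; the block that ends
  up in place $j$ comes from place $\tau^{-1}(j)$. The value is immaterial when the number of
  blocks is not the degree.\<close>

lift_definition place_act :: "permutation \<Rightarrow> set_composition \<Rightarrow> set_composition" is
  "\<lambda>(k, f) \<Phi>. if length \<Phi> = k then map (\<lambda>j. \<Phi> ! (inv f j - 1)) [1..<Suc k] else \<Phi>"
proof -
  fix \<tau> :: "nat \<times> (nat \<Rightarrow> nat)" and \<Phi>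
  assume "\<tau> \<in> {(n, f). f permutes {1..n}}" and "\<exists>n. is_set_composition n \<Phi>"
  moreover obtain k f where "\<tau> = (k, f)" by fastforce
  ultimately show "\<exists>n. is_set_composition n ((case \<tau> of (k, f) \<Rightarrow> \<lambda>\<Phi>. if length \<Phi> = k
      then map (\<lambda>j. \<Phi> ! (inv f j - 1)) [1..<Suc k] else \<Phi>) \<Phi>)"
    using is_set_composition_permuted[of f \<Phi>] by (auto simp del: upt_Suc)
qed

end

theory Submission
  imports Defs
begin

text \<open>
  Write \<open>p\<close> for the list $\tau^{-1}(1), \dots, \tau^{-1}(n)$. Reading the blocks of a set composition
  one after the other, each in increasing order, gives a list. For \<open>setcomp u\<close> this list is the
  order in which standardization labels the positions of \<open>u\<close>, so \<open>st u = \<tau>\<close> iff it is \<open>p\<close>. On the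
  other hand, merging singletons across a set of ascents of \<open>p\<close> produces exactly the set
  compositions that read \<open>p\<close>. As \<open>setcomp\<close> is a bijection, the two sums agree term by term.
\<close>

abbreviation reading :: "nat set list \<Rightarrow> nat list" where
  "reading \<Phi> \<equiv> concat (map sorted_list_of_set \<Phi>)"

abbreviation singleton_blocks :: "nat list \<Rightarrow> nat set list" where
  "singleton_blocks p \<equiv> map (\<lambda>x. {x}) p"

section \<open>Increasing enumerations of finite sets\<close>

lemma sorted_list_of_set_eqI:
  assumes "sorted_wrt (<) xs" "set xs = A"
  shows "sorted_list_of_set A = xs"
  using assms strict_sorted_iff[of xs] sorted_list_of_set.idem_if_sorted_distinct by blast

lemma sorted_list_of_set_union_max:
  fixes x :: nat
  assumes "finite B" "B \<noteq> {}" "Max B < x"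
  shows "sorted_list_of_set (B \<union> {x}) = sorted_list_of_set B @ [x]"
  using assms by (intro sorted_list_of_set_eqI) (auto simp: sorted_wrt_append)

lemma inj_on_sorted_list_of_set: "inj_on sorted_list_of_set {A :: nat set. finite A}"
  by (intro inj_onI) (metis mem_Collect_eq set_sorted_list_of_set)


section \<open>Merging singletons\<close>

text \<open>The recursion tests only indices from \<open>i\<close> upwards. Hence an earlier index
  can be added to a set chosen for the later places without changing their merge.\<close>

lemma merge_from_cong:
  assumes "\<And>j. i \<le> j \<Longrightarrow> j \<in> I \<longleftrightarrow> j \<in> J"
  shows "merge_from i I \<Phi> = merge_from i J \<Phi>"
  using assms by (induction i I \<Phi> rule: merge_from.induct) auto

text \<open>The head is an arbitrary block \<open>B\<close> so that the induction can follow a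
  growing block. Its last absorbed entry is \<open>Max B\<close>, so a merge at an ascent appends
  the next entry to the sorted list of \<open>B\<close> and the reading is preserved.\<close>

lemma reading_merge_from:
  assumes "finite B" "B \<noteq> {}"
    and "\<And>j. j < length p \<Longrightarrow> i + j \<in> I \<Longrightarrow> (Max B # p) ! j < p ! j"
  shows "reading (merge_from i I (B # singleton_blocks p)) = sorted_list_of_set B @ p"
  using assms
proof (induction p arbitrary: i B)
  case (Cons x p)
  have step: "(x # p) ! j < p ! j" if "j < length p" "Suc i + j \<in> I" for j
    using Cons.prems(3)[of "Suc j"] that by simp
  show ?case
  proof (cases "i \<in> I")
    case True
    then have less: "Max B < x" using Cons.prems(3)[of 0] by simp
    then have "Max (B \<union> {x}) = x" using Cons.prems by simp
    then have "reading (merge_from (Suc i) I ((B \<union> {x}) # singleton_blocks p)) =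
        sorted_list_of_set (B \<union> {x}) @ p"
      using Cons.prems step by (intro Cons.IH) auto
    then show ?thesis using True less Cons.prems(1,2) sorted_list_of_set_union_max by simp
  next
    case False
    have "reading (merge_from (Suc i) I ({x} # singleton_blocks p)) = sorted_list_of_set {x} @ p"
      using step by (intro Cons.IH) auto
    then show ?thesis using False by simp
  qed
qed simp

text \<open>The block sizes of \<Psi> dictate the merges: absorb entries into \<open>B\<close> until
  it is as large as the first block, then start a new block. The bound on \<open>card B\<close>
  ensures that the first block of \<Psi> does not end inside \<open>B\<close>, so \<open>B\<close>
  consists of its smallest elements.\<close>

lemma merge_from_surj:
  assumes "reading \<Psi> = sorted_list_of_set B @ p" "\<forall>C \<in> set \<Psi>. finite C \<and> C \<noteq> {}"
    and "finite B" "B \<noteq> {}" "card B \<le> card (hd \<Psi>)"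
  shows "\<exists>I \<subseteq> {i + j | j. j < length p \<and> (Max B # p) ! j < p ! j}.
    merge_from i I (B # singleton_blocks p) = \<Psi>"
  using assms
proof (induction p arbitrary: i B \<Psi>)
  case Nil
  then have "reading \<Psi> \<noteq> []" by simp
  then obtain C \<Psi>' where \<Psi>: "\<Psi> = C # \<Psi>'" by (cases \<Psi>) auto
  have "sorted_list_of_set C @ reading \<Psi>' = sorted_list_of_set B" using Nil \<Psi> by simp
  \<comment> \<open>As \<open>C\<close> is at least as large as \<open>B\<close>, nothing is left
    for the blocks after it; since those blocks are nonempty, there are none.\<close>
  from arg_cong[OF this, of length] have "length (reading \<Psi>') = 0"
    using Nil.prems(5) \<Psi> by (simp del: length_0_conv)
  then have "reading \<Psi>' = []" by (simp only: length_0_conv)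
  then have "\<Psi>' = []" using Nil \<Psi> by (cases \<Psi>') auto
  then have "C = B"
    using Nil \<Psi> inj_onD[OF inj_on_sorted_list_of_set, of C B] by simp
  then show ?case using \<Psi> \<open>\<Psi>' = []\<close> by auto
next
  case (Cons x p)
  then obtain C \<Psi>' where \<Psi>: "\<Psi> = C # \<Psi>'" by (cases \<Psi>) auto
  have C: "finite C" "C \<noteq> {}" using Cons.prems \<Psi> by auto
  have eq: "sorted_list_of_set C @ reading \<Psi>' = sorted_list_of_set B @ x # p"
    using Cons.prems(1) \<Psi> by simp
  \<comment> \<open>Whether or not a merge happens at \<open>i\<close>, the new head has maximum
    \<open>x\<close>. So both cases recurse with the same set of later ascents, whose absolute
    indices are unchanged.\<close>
  have shift: "{Suc i + j | j. j < length p \<and> (x # p) ! j < p ! j} \<subseteq>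
      {i + j | j. j < length (x # p) \<and> (Max B # x # p) ! j < (x # p) ! j}"
  proof clarify
    fix j assume "j < length p" "(x # p) ! j < p ! j"
    then show "\<exists>j'. Suc i + j = i + j' \<and> j' < length (x # p) \<and>
        (Max B # x # p) ! j' < (x # p) ! j'"
      by (intro exI[of _ "Suc j"]) simp
  qed
  show ?case
  proof (cases "card B = card C")
    case True
    then have "length (sorted_list_of_set C) = length (sorted_list_of_set B)" by simp
    with eq have "sorted_list_of_set C = sorted_list_of_set B" "reading \<Psi>' = x # p" by auto
    then have "C = B" and rd: "reading \<Psi>' = sorted_list_of_set {x} @ p"
      using inj_onD[OF inj_on_sorted_list_of_set, of C B] C Cons.prems(3) by auto
    have "\<Psi>' \<noteq> []" using rd by auto
    then have "hd \<Psi>' \<in> set \<Psi>" using \<Psi> by simp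
    then have "card {x} \<le> card (hd \<Psi>')"
      using Cons.prems(2) by (simp add: Suc_le_eq card_gt_0_iff)
    then obtain I where I: "I \<subseteq> {Suc i + j | j. j < length p \<and> (x # p) ! j < p ! j}"
        "merge_from (Suc i) I ({x} # singleton_blocks p) = \<Psi>'"
      using Cons.IH[of \<Psi>' "{x}" "Suc i"] rd Cons.prems(2) \<Psi> by auto
    \<comment> \<open>All elements of \<open>I\<close> are at least \<open>Suc i\<close>, so the
      block \<open>B\<close> stays closed.\<close>
    then have "i \<notin> I" by auto
    then have "merge_from i I (B # singleton_blocks (x # p)) = \<Psi>"
      using I \<Psi> \<open>C = B\<close> by simp
    then show ?thesis using order_trans[OF I(1) shift] by (intro exI[of _ I]) simp
  next
    case False
    then have "length (sorted_list_of_set B) < length (sorted_list_of_set C)"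
      using Cons.prems(5) \<Psi> by simp
    \<comment> \<open>Two prefixes of one list are comparable. Since \<open>C\<close> is larger than
      \<open>B\<close>, its sorted list extends that of \<open>B\<close>, and the first entry added
      is \<open>x\<close>; sortedness then makes \<open>i\<close> an ascent.\<close>
    moreover obtain us where "sorted_list_of_set C = sorted_list_of_set B @ us \<and> us @ reading \<Psi>' = x # p
        \<or> sorted_list_of_set C @ us = sorted_list_of_set B"
      using eq unfolding append_eq_append_conv2 by blast
    ultimately have us: "sorted_list_of_set C = sorted_list_of_set B @ us" "us \<noteq> []"
        "us @ reading \<Psi>' = x # p"
      by (metis append_Nil2 length_append less_irrefl not_add_less1)+
    then obtain r where r: "sorted_list_of_set C = sorted_list_of_set B @ x # r"
      by (cases us) auto
    then have "sorted_wrt (<) (sorted_list_of_set B @ x # r)"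
      using strict_sorted_list_of_set[of C] by simp
    then have less: "Max B < x" using Cons.prems(3,4) by (auto simp: sorted_wrt_append)
    then have max: "Max (B \<union> {x}) = x" using Cons.prems by simp
    have sl: "sorted_list_of_set (B \<union> {x}) = sorted_list_of_set B @ [x]"
      using less Cons.prems by (intro sorted_list_of_set_union_max)
    have "card (B \<union> {x}) \<le> card C"
      using arg_cong[OF r, of length] arg_cong[OF sl, of length] by simp
    then obtain I where I: "I \<subseteq> {Suc i + j | j. j < length p \<and> (x # p) ! j < p ! j}"
        "merge_from (Suc i) I ((B \<union> {x}) # singleton_blocks p) = \<Psi>"
      using Cons.IH[of \<Psi> "B \<union> {x}" "Suc i"] sl Cons.prems \<Psi> unfolding max by auto
    have "merge_from (Suc i) (insert i I) ((B \<union> {x}) # singleton_blocks p) = \<Psi>"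
      unfolding I(2)[symmetric] by (rule merge_from_cong) auto
    then have "merge_from i (insert i I) (B # singleton_blocks (x # p)) = \<Psi>" by simp
    moreover have "i \<in> {i + j | j. j < length (x # p) \<and> (Max B # x # p) ! j < (x # p) ! j}"
      using less by (intro CollectI exI[of _ 0]) simp
    ultimately show ?thesis
      using order_trans[OF I(1) shift] by (intro exI[of _ "insert i I"] conjI insert_subsetI)
  qed
qed

text \<open>Singletons have equal size, so \<open>gt_D\<close> is decided by the minima alone, and
  these are the entries of \<open>p\<close>.\<close>

lemma mergeable_singletons:
  "mergeable (singleton_blocks p) = {i. 1 \<le> i \<and> i < length p \<and> p ! (i - 1) < p ! i}"
  by (auto simp: mergeable_def gt_D_def)

text \<open>Both directions start the accumulated block at the first entry of \<open>p\<close>. The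
  assumption on \<Psi> matters because empty or infinite blocks leave no trace in a reading.\<close>

lemma merge_singletons_iff:
  assumes "\<forall>C \<in> set \<Psi>. finite C \<and> C \<noteq> {}"
  shows "(\<exists>I \<subseteq> mergeable (singleton_blocks p). \<Psi> = merge I (singleton_blocks p)) \<longleftrightarrow>
    reading \<Psi> = p"
proof (cases p)
  case Nil
  then show ?thesis using assms by (cases \<Psi>) (auto simp: merge_def)
next
  case (Cons x q)
  \<comment> \<open>Places count from 1 and list indices from 0. The substitution
    \<open>i = 1 + j\<close> gives the form used in the two recursive lemmas, with \<open>x\<close>
    as \<open>Max {x}\<close>.\<close>
  have asc: "mergeable (singleton_blocks p) =
      {1 + j | j. j < length q \<and> (x # q) ! j < q ! j}"
  proof (intro set_eqI iffI)
    fix i assume "i \<in> mergeable (singleton_blocks p)"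
    then show "i \<in> {1 + j | j. j < length q \<and> (x # q) ! j < q ! j}"
      unfolding mergeable_singletons Cons by (intro CollectI exI[of _ "i - 1"]) auto
  qed (unfold mergeable_singletons, auto simp: Cons)
  show ?thesis
  proof
    assume "\<exists>I \<subseteq> mergeable (singleton_blocks p). \<Psi> = merge I (singleton_blocks p)"
    then obtain I where I: "I \<subseteq> mergeable (singleton_blocks p)"
      "\<Psi> = merge_from 1 I ({x} # singleton_blocks q)"
      unfolding Cons merge_def by auto
    have "reading \<Psi> = sorted_list_of_set {x} @ q"
      unfolding I(2) using I(1) unfolding asc by (intro reading_merge_from) auto
    then show "reading \<Psi> = p" using Cons by simp
  next
    assume rd: "reading \<Psi> = p"
    then have "hd \<Psi> \<in> set \<Psi>" using Cons by (intro hd_in_set) auto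
    then have "card {x} \<le> card (hd \<Psi>)" using assms by (simp add: Suc_le_eq card_gt_0_iff)
    then have "\<exists>I \<subseteq> {1 + j | j. j < length q \<and> (Max {x} # q) ! j < q ! j}.
        merge_from 1 I ({x} # singleton_blocks q) = \<Psi>"
      using assms rd Cons by (intro merge_from_surj) auto
    then show "\<exists>I \<subseteq> mergeable (singleton_blocks p). \<Psi> = merge I (singleton_blocks p)"
      unfolding asc by (auto simp: Cons merge_def)
  qed
qed


section \<open>Packed words and set compositions\<close>

lemma is_set_composition_blocks: "\<exists>n. is_set_composition n (blocks \<Phi>)"
  using blocks[of \<Phi>] by simp

lemma blocks_finite_nonempty: "\<forall>C \<in> set (blocks \<Phi>). finite C \<and> C \<noteq> {}"
proof -
  obtain n where "is_set_composition n (blocks \<Phi>)" using is_set_composition_blocks by blast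
  then show ?thesis
    unfolding is_set_composition_def by (metis Union_upper finite_atLeastAtMost finite_subset)
qed

text \<open>Sorting the positions of a letter lists them from left to right, which is how
  standardization visits them.\<close>

lemma reading_setcomp: "reading (blocks (setcomp u)) = labelling_order (letters u)"
proof -
  have "sorted_list_of_set {i \<in> {1..length w}. w ! (i - 1) = a} =
      filter (\<lambda>i. w ! (i - 1) = a) [1..<Suc (length w)]" for w :: "nat list" and a
    by (intro sorted_list_of_set_eqI sorted_wrt_filter sorted_wrt_upt) auto
  then show ?thesis
    by (simp add: setcomp.rep_eq labelling_order_def comp_def del: upt_Suc)
qed

lemma letters_set: "\<exists>k. set (letters u) = {1..k}"
  using letters[of u] by simp

text \<open>The number of blocks gives the largest letter, and the letter at a position is the index
  of the block containing that position.\<close>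

lemma inj_setcomp: "inj setcomp"
proof (rule injI)
  fix u v assume "setcomp u = setcomp v"
  moreover obtain k l where k: "set (letters u) = {1..k}" "set (letters v) = {1..l}"
    using letters_set by meson
  ultimately have eq: "map (\<lambda>a. {i \<in> {1..length (letters u)}. letters u ! (i - 1) = a}) [1..<Suc k] =
      map (\<lambda>a. {i \<in> {1..length (letters v)}. letters v ! (i - 1) = a}) [1..<Suc l]"
    using setcomp.rep_eq[of u] setcomp.rep_eq[of v] by simp
  then have "k = l" by (auto dest: arg_cong[of _ _ length] simp del: upt_Suc)
  with eq have blk: "{i \<in> {1..length (letters u)}. letters u ! (i - 1) = a} =
      {i \<in> {1..length (letters v)}. letters v ! (i - 1) = a}" if "a \<in> {1..k}" for a
    using that by (auto simp del: upt_Suc)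
  have letter: "letters x ! i \<in> {1..k}" if "x \<in> {u, v}" "i < length (letters x)" for x i
    using that k \<open>k = l\<close> nth_mem[of i "letters x"] by blast
  have u: "i < length (letters v) \<and> letters v ! i = letters u ! i"
    if "i < length (letters u)" for i
  proof -
    have "Suc i \<in> {j \<in> {1..length (letters v)}. letters v ! (j - 1) = letters u ! i}"
      using that letter[of u i] by (subst blk[symmetric]) auto
    then show ?thesis by auto
  qed
  have v: "i < length (letters u)" if "i < length (letters v)" for i
  proof -
    have "Suc i \<in> {j \<in> {1..length (letters u)}. letters u ! (j - 1) = letters v ! i}"
      using that letter[of v i] by (subst blk) auto
    then show ?thesis by auto
  qed
  have "length (letters u) = length (letters v)" using u v by (metis linorder_neqE_nat less_irrefl)
  then have "letters u = letters v" using u by (intro nth_equalityI) auto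
  then show "u = v" by (simp add: letters_inject)
qed

lemma surj_setcomp: "surj setcomp"
proof -
  have "\<exists>u. setcomp u = \<Phi>" for \<Phi>
  proof -
    obtain n where c: "is_set_composition n (blocks \<Phi>)" using is_set_composition_blocks by blast
    define k where "k = length (blocks \<Phi>)"
    have "\<exists>a. a \<in> {1..k} \<and> i \<in> blocks \<Phi> ! (a - 1)" if "i \<in> {1..n}" for i
    proof -
      have "i \<in> \<Union> (set (blocks \<Phi>))" using that c unfolding is_set_composition_def by simp
      then obtain b where "b < k" "i \<in> blocks \<Phi> ! b" by (auto simp: in_set_conv_nth k_def)
      then show ?thesis by (intro exI[of _ "Suc b"]) auto
    qed
    \<comment> \<open>The letter of the word at position \<open>i\<close> is to be the index of a
      block containing \<open>i\<close>; disjointness of the blocks makes it unique.\<close>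
    then obtain g where g: "\<And>i. i \<in> {1..n} \<Longrightarrow> g i \<in> {1..k} \<and> i \<in> blocks \<Phi> ! (g i - 1)"
      by metis
    have sub: "blocks \<Phi> ! (a - 1) \<subseteq> {1..n} \<and> blocks \<Phi> ! (a - 1) \<noteq> {}" if "a \<in> {1..k}" for a
    proof -
      have "blocks \<Phi> ! (a - 1) \<in> set (blocks \<Phi>)" using that by (intro nth_mem) (auto simp: k_def)
      then show ?thesis using c unfolding is_set_composition_def by (metis Union_upper)
    qed
    have disj: "a = b" if "i \<in> blocks \<Phi> ! (a - 1)" "i \<in> blocks \<Phi> ! (b - 1)"
      "a \<in> {1..k}" "b \<in> {1..k}" for i a b
    proof (rule ccontr)
      assume "a \<noteq> b"
      then have "a - 1 < b - 1 \<or> b - 1 < a - 1" "a - 1 < k" "b - 1 < k" using that by auto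
      then have "blocks \<Phi> ! (a - 1) \<inter> blocks \<Phi> ! (b - 1) = {}"
        using c unfolding is_set_composition_def k_def by (metis Int_commute)
      then show False using that by blast
    qed
    have blk: "{i \<in> {1..n}. g i = a} = blocks \<Phi> ! (a - 1)" if "a \<in> {1..k}" for a
      using g sub[OF that] disj that by blast
    define w where "w = map g [1..<Suc n]"
    have "set w = g ` {1..n}" by (auto simp: w_def simp del: upt_Suc simp: less_Suc_eq_le)
    \<comment> \<open>No block is empty, so every index up to \<open>k\<close> occurs as a letter:
      the word is packed.\<close>
    also have "\<dots> = {1..k}"
    proof (intro equalityI subsetI)
      fix a assume a: "a \<in> {1..k}"
      then obtain i where "i \<in> {i \<in> {1..n}. g i = a}" using sub[OF a] blk[OF a] by blast
      then show "a \<in> g ` {1..n}" by blast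
    next
      fix a assume "a \<in> g ` {1..n}"
      then obtain i where "i \<in> {1..n}" "a = g i" by (rule imageE)
      then show "a \<in> {1..k}" using g[of i] by simp
    qed
    finally have set: "set w = {1..k}" .
    then have w: "letters (Abs_packed_word w) = w" by (intro Abs_packed_word_inverse) blast
    have "blocks (setcomp (Abs_packed_word w)) =
        map (\<lambda>a. {i \<in> {1..n}. w ! (i - 1) = a}) [1..<Suc k]"
      unfolding setcomp.rep_eq w using set by (simp add: w_def del: upt_Suc)
    also have "\<dots> = map (\<lambda>a. {i \<in> {1..n}. g i = a}) [1..<Suc k]"
      by (intro map_cong) (auto simp: w_def simp del: upt_Suc)
    also have "\<dots> = blocks \<Phi>"
      using blk by (intro nth_equalityI) (auto simp: k_def simp del: upt_Suc)
    finally show "\<exists>u. setcomp u = \<Phi>" by (auto simp: blocks_inject)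
  qed
  then show ?thesis unfolding surj_def by metis
qed


section \<open>Standardization\<close>

definition inverse_list :: "permutation \<Rightarrow> nat list" where
  "inverse_list \<tau> = map (inv (perm_fun \<tau>)) [1..<Suc (degree \<tau>)]"

lemma perm_fun_permutes: "perm_fun \<tau> permutes {1..degree \<tau>}"
  using Rep_permutation[of \<tau>] by (auto simp: perm_fun.rep_eq degree.rep_eq)

text \<open>Standardization labels the entries of the labelling order consecutively, so the entry in
  place \<open>r\<close> of that order is the preimage of \<open>r\<close> under
  \<open>st u\<close>.\<close>

lemma st_eq_iff: "st u = \<tau> \<longleftrightarrow> labelling_order (letters u) = inverse_list \<tau>"
proof -
  define w where "w = letters u"
  define f where "f = perm_fun \<tau>"
  define n where "n = degree \<tau>"
  define xs where "xs = labelling_order w"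
  obtain k where k: "set w = {1..k}" using letters_set w_def by blast
  note label = standard_label_nth[OF k, folded xs_def]
  have xs: "set xs = {1..length w}" "length xs = length w"
    using labelling_order_permutation[OF k] distinct_card[of xs] by (auto simp: xs_def)
  have f: "f permutes {1..n}" using perm_fun_permutes f_def n_def by simp
  have len: "length (inverse_list \<tau>) = n" by (simp add: inverse_list_def n_def)
  have nth: "inverse_list \<tau> ! r = inv f (Suc r)" if "r < n" for r
    using that by (simp add: inverse_list_def n_def f_def del: upt_Suc)
  have "st u = \<tau> \<longleftrightarrow> Rep_permutation (st u) = (n, f)"
    by (metis Rep_permutation_inject degree.rep_eq f_def n_def perm_fun.rep_eq prod.collapse)
  also have "\<dots> \<longleftrightarrow> length w = n \<and>
      (\<lambda>i. if i \<in> {1..length w} then standard_label w i else i) = f"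
    unfolding st.rep_eq w_def by simp
  also have "\<dots> \<longleftrightarrow> length w = n \<and> (\<forall>i \<in> {1..n}. standard_label w i = f i)"
    using permutes_not_in[OF f] by (auto simp: fun_eq_iff)
  \<comment> \<open>The entries of \<open>xs\<close> are exactly the positions of \<open>w\<close>.
    As the label of \<open>xs ! r\<close> is \<open>Suc r\<close>, inverting \<open>f\<close> then
    determines \<open>xs\<close>.\<close>
  also have "\<dots> \<longleftrightarrow> length w = n \<and> (\<forall>r < n. standard_label w (xs ! r) = f (xs ! r))"
    using xs by (metis in_set_conv_nth)
  also have "\<dots> \<longleftrightarrow> length w = n \<and> (\<forall>r < n. xs ! r = inv f (Suc r))"
    using label permutes_inverses[OF f] by metis
  also have "\<dots> \<longleftrightarrow> xs = inverse_list \<tau>"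
    unfolding list_eq_iff_nth_eq using xs(2) len nth by metis
  finally show ?thesis by (simp add: xs_def w_def)
qed

section \<open>Comparison of the two monomial expansions\<close>

lemma fqsym_to_ncqsym_G_reading:
  "fqsym_to_ncqsym (G \<tau> :: 'a::comm_ring_1 fqsym) =
    (\<Sum>\<Psi> | reading (blocks \<Psi>) = inverse_list \<tau>. M \<Psi>)"
proof -
  \<comment> \<open>The fibre of \<open>st\<close> is carried onto compositions with a fixed
    reading; injectivity of \<open>setcomp\<close> keeps every coefficient equal to 1.\<close>
  have "setcomp ` {u. st u = \<tau>} = {\<Psi>. reading (blocks \<Psi>) = inverse_list \<tau>}"
  proof (intro equalityI subsetI)
    fix \<Psi> assume "\<Psi> \<in> {\<Psi>. reading (blocks \<Psi>) = inverse_list \<tau>}"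
    moreover obtain u where "\<Psi> = setcomp u" using surj_setcomp by blast
    ultimately show "\<Psi> \<in> setcomp ` {u. st u = \<tau>}" by (auto simp: st_eq_iff reading_setcomp)
  qed (auto simp: st_eq_iff reading_setcomp)
  moreover have "inj_on setcomp {u. st u = \<tau>}" using inj_setcomp by (rule inj_on_subset) simp
  ultimately show ?thesis
    unfolding fqsym_to_ncqsym_G by (intro sum.reindex_cong[symmetric]) auto
qed

text \<open>The sum defining \<open>P\<close> runs over compositions rather than over the sets
  \<open>I\<close>, so it suffices to identify its index set.\<close>

lemma P_singletons:
  assumes "blocks \<Phi> = singleton_blocks p"
  shows "P \<Phi> = (\<Sum>\<Psi> | reading (blocks \<Psi>) = p. M \<Psi>)"
  unfolding P_def assms merge_singletons_iff[OF blocks_finite_nonempty] ..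

lemma fqsym_to_ncqsym_G_eq_P:
  assumes "blocks \<Phi> = singleton_blocks (inverse_list \<tau>)"
  shows "fqsym_to_ncqsym (G \<tau>) = P \<Phi>"
  using fqsym_to_ncqsym_G_reading P_singletons[OF assms] by metis

text \<open>Place \<open>i\<close> of the composition \<open>singletons\<close> holds the block
  \<open>{i}\<close>, so the block arriving in place \<open>j\<close> consists of the preimage of
  \<open>j\<close>.\<close>

lemma blocks_place_act_singletons:
  "blocks (place_act \<tau> (singletons (degree \<tau>))) = singleton_blocks (inverse_list \<tau>)"
proof -
  let ?n = "degree \<tau>" and ?f = "perm_fun \<tau>"
  have "Rep_permutation \<tau> = (?n, ?f)" by (simp add: degree.rep_eq perm_fun.rep_eq)
  then have "blocks (place_act \<tau> (singletons ?n)) =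
      map (\<lambda>j. singleton_blocks [1..<Suc ?n] ! (inv ?f j - 1)) [1..<Suc ?n]"
    by (simp add: place_act.rep_eq singletons.rep_eq del: upt_Suc)
  also have "\<dots> = map (\<lambda>j. {inv ?f j}) [1..<Suc ?n]"
  proof (rule map_cong[OF refl])
    fix j assume "j \<in> set [1..<Suc ?n]"
    then have "inv ?f j \<in> {1..?n}"
      using permutes_in_image[OF permutes_inv[OF perm_fun_permutes[of \<tau>]], of j] by auto
    then show "singleton_blocks [1..<Suc ?n] ! (inv ?f j - 1) = {inv ?f j}"
      by (auto simp del: upt_Suc)
  qed
  finally show ?thesis by (simp add: inverse_list_def comp_def del: upt_Suc)
qed

section \<open>All compositions into singletons come from permutations\<close>

lemma inverse_list_surj:
  assumes "distinct p" "set p = {1..n}"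
  shows "\<exists>\<tau>. inverse_list \<tau> = p"
proof -
  have len: "length p = n" using assms distinct_card by fastforce
  \<comment> \<open>This is the permutation with one-line notation \<open>p\<close>, extended by the
    identity as \<open>permutes\<close> requires. Its inverse serves as \<tau>, because
    \<open>inverse_list\<close> lists the values of the inverse.\<close>
  define g where "g j = (if j \<in> {1..n} then p ! (j - 1) else j)" for j
  have "bij_betw (\<lambda>j. p ! (j - 1)) {1..n} {1..n}"
  proof (rule bij_betw_trans[of "\<lambda>j. j - 1" _ "{..<n}" "(!) p", unfolded comp_def])
    show "bij_betw (\<lambda>j. j - 1) {1..n} {..<n}" by (rule bij_betw_byWitness[of _ Suc]) auto
    show "bij_betw ((!) p) {..<n} {1..n}" using assms len by (intro bij_betw_nth) auto
  qed
  then have "bij_betw g {1..n} {1..n}"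
    by (rule bij_betw_cong[THEN iffD1, rotated]) (simp add: g_def)
  then have g: "g permutes {1..n}" by (rule bij_imp_permutes) (auto simp: g_def)
  define \<tau> where "\<tau> = Abs_permutation (n, inv g)"
  have "Rep_permutation \<tau> = (n, inv g)"
    unfolding \<tau>_def using permutes_inv[OF g] by (intro Abs_permutation_inverse) simp
  then have "inverse_list \<tau> = map g [1..<Suc n]"
    using permutes_inv_inv[OF g] by (simp add: inverse_list_def degree.rep_eq perm_fun.rep_eq)
  also have "\<dots> = p" using len by (intro nth_equalityI) (auto simp: g_def simp del: upt_Suc)
  finally show ?thesis by blast
qed

text \<open>Disjointness and covering make the elements of the singletons a list without repetitions
  of all of \<open>{1..n}\<close>. This shows that every \<open>P\<close> of a singleton composition
  lies in the image of the basis \<open>G\<close>.\<close>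

lemma singleton_composition_inverse_list:
  assumes "\<forall>B \<in> set (blocks \<Phi>). is_singleton B"
  shows "\<exists>\<tau>. blocks \<Phi> = singleton_blocks (inverse_list \<tau>)"
proof -
  obtain n where c: "is_set_composition n (blocks \<Phi>)" using is_set_composition_blocks by blast
  define p where "p = map the_elem (blocks \<Phi>)"
  have p: "blocks \<Phi> = singleton_blocks p"
    using assms by (auto simp: p_def is_singleton_the_elem intro!: map_idI[symmetric])
  have "\<Union> (set (singleton_blocks p)) = {1..n}"
    using c unfolding is_set_composition_def p by blast
  then have "set p = {1..n}" by auto
  moreover have "p ! i \<noteq> p ! j" if "i < j" "j < length p" for i j
  proof -
    have "singleton_blocks p ! i \<inter> singleton_blocks p ! j = {}"
      using c that unfolding is_set_composition_def p by simp
    then show ?thesis using that by simp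
  qed
  then have "distinct p" unfolding distinct_conv_nth by (metis linorder_neqE_nat)
  ultimately obtain \<tau> where "inverse_list \<tau> = p" using inverse_list_surj by blast
  then show ?thesis using p by blast
qed

theorem theorem16:
  shows "(\<forall>n. \<forall>\<tau> \<in> symmetric_group n.
      fqsym_to_ncqsym (G \<tau> :: 'a::comm_ring_1 fqsym) = P (place_act \<tau> (singletons n))) \<and>
    fqsym_to_ncqsym ` range (G :: permutation \<Rightarrow> 'a fqsym) =
      {P \<Phi> | \<Phi>. \<forall>B \<in> set (blocks \<Phi>). is_singleton B}"
proof
  show "\<forall>n. \<forall>\<tau> \<in> symmetric_group n.
      fqsym_to_ncqsym (G \<tau> :: 'a fqsym) = P (place_act \<tau> (singletons n))"
    using fqsym_to_ncqsym_G_eq_P blocks_place_act_singletons by (auto simp: symmetric_group_def)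
  show "fqsym_to_ncqsym ` range (G :: permutation \<Rightarrow> 'a fqsym) =
      {P \<Phi> | \<Phi>. \<forall>B \<in> set (blocks \<Phi>). is_singleton B}"
  proof (intro equalityI subsetI)
    fix x assume "x \<in> fqsym_to_ncqsym ` range (G :: permutation \<Rightarrow> 'a fqsym)"
    then obtain \<tau> where "x = fqsym_to_ncqsym (G \<tau>)" by blast
    then have "x = P (place_act \<tau> (singletons (degree \<tau>)))"
      using fqsym_to_ncqsym_G_eq_P blocks_place_act_singletons by metis
    moreover have "\<forall>B \<in> set (blocks (place_act \<tau> (singletons (degree \<tau>)))). is_singleton B"
      unfolding blocks_place_act_singletons by (auto simp: is_singleton_def)
    ultimately show "x \<in> {P \<Phi> | \<Phi>. \<forall>B \<in> set (blocks \<Phi>). is_singleton B}" by blast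
  next
    fix x :: "'a ncqsym"
    assume "x \<in> {P \<Phi> | \<Phi>. \<forall>B \<in> set (blocks \<Phi>). is_singleton B}"
    then obtain \<Phi> where x: "x = P \<Phi>" "\<forall>B \<in> set (blocks \<Phi>). is_singleton B" by blast
    then obtain \<tau> where "blocks \<Phi> = singleton_blocks (inverse_list \<tau>)"
      using singleton_composition_inverse_list by blast
    then have "x = fqsym_to_ncqsym (G \<tau>)" using x(1) fqsym_to_ncqsym_G_eq_P by metis
    then show "x \<in> fqsym_to_ncqsym ` range (G :: permutation \<Rightarrow> 'a fqsym)" by blast
  qed
qed

end
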